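(* Consider the Histogram Partitioning algorithm (described in the context) on $N$ distinct keys over $p$ processors, where in round $j$ each key of $\gamma_j$ is sampled independently with probability $\frac{cp}{|\gamma_j|\log^* p}$ with $c=3\ln 2.5$. Let $t\ge 1$. If the number $k$ of unachieved splitters at the start of round $j$ satisfies $k\le\frac{p}{t\log^* p}$, then with high probability the number of unachieved splitters after round $j$ is at most $\max\left(\frac{p}{\log p\,\log^* p},\ \frac{p}{t\,2^t\log^* p}\right)$.
   Context: Setting: $N$ distinct keys from a totally ordered set are distributed across $p$ processors, $N/p$ keys per processor. For $\ell\in\{1,\dots,p-1\}$, the target range of splitter $\ell$ is the rank range $[\frac{N\ell}{p},\frac{N\ell}{p}+\frac{N}{p}]$; splitter $\ell$ is achieved in a round if some key with rank in this range is sampled in that round (and stays achieved afterwards). Histogram Partitioning proceeds in rounds; in round $j$, keys are sampled independently from a set $\gamma_j$ ($\gamma_1$ = all keys), and the global ranks of the samples are computed and made known to all processors. For each unachieved splitter $\ell$, $L_j(\ell)$ is the largest key sampled before round $j$ with rank below $\frac{N\ell}{p}$ (or the smallest key) and $U_j(\ell)$ the smallest key sampled before round $j$ with rank above $\frac{N\ell}{p}+\frac{N}{p}$ (or the largest key); $\gamma_j$ is the union over splitters $\ell$ unachieved before round $j$ of the keys between $L_j(\ell)$ and $U_j(\ell)$. $\log^* x=0$ for $x\le1$ and $\log^* x=1+\log^*(\log x)$ for $x>1$. "With high probability" means with probability tending to $1$ as $p\to\infty$ (the paper's bound is $1-e^{-p/(40\log p\log^* p)}$). *)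

theory Defs
  imports "HOL-Probability.Probability"
begin

text \<open>Keys are identified with their global ranks 1..N (distinct keys from a totally
ordered set; the algorithm only depends on the order).  A state of the algorithm before
a round is the set S of ranks of all keys sampled in previous rounds.\<close>

definition logstar :: "real \<Rightarrow> nat" where
  "logstar x = (LEAST n. ((\<lambda>y. log 2 y) ^^ n) x \<le> 1)"

definition tlo :: "nat \<Rightarrow> nat \<Rightarrow> nat \<Rightarrow> real" where
  "tlo N p l = real N * real l / real p"

definition thi :: "nat \<Rightarrow> nat \<Rightarrow> nat \<Rightarrow> real" where
  "thi N p l = real N * real l / real p + real N / real p"

definition achieved :: "nat \<Rightarrow> nat \<Rightarrow> nat set \<Rightarrow> nat \<Rightarrow> bool" where
  "achieved N p S l \<longleftrightarrow> (\<exists>x\<in>S. tlo N p l \<le> real x \<and> real x \<le> thi N p l)"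

definition unach :: "nat \<Rightarrow> nat \<Rightarrow> nat set \<Rightarrow> nat set" where
  "unach N p S = {l \<in> {1..p-1}. \<not> achieved N p S l}"

definition Lkey :: "nat \<Rightarrow> nat \<Rightarrow> nat set \<Rightarrow> nat \<Rightarrow> nat" where
  "Lkey N p S l = (if {x\<in>S. real x < tlo N p l} = {} then 1
                   else Max {x\<in>S. real x < tlo N p l})"

definition Ukey :: "nat \<Rightarrow> nat \<Rightarrow> nat set \<Rightarrow> nat \<Rightarrow> nat" where
  "Ukey N p S l = (if {x\<in>S. real x > thi N p l} = {} then N
                   else Min {x\<in>S. real x > thi N p l})"

definition gamma :: "nat \<Rightarrow> nat \<Rightarrow> nat set \<Rightarrow> nat set" where
  "gamma N p S = (\<Union>l\<in>unach N p S. {Lkey N p S l .. Ukey N p S l})"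

definition hp_c :: real where
  "hp_c = 3 * ln 2.5"

text \<open>Sampling probability of a round (capped at 1 so that it is a probability).\<close>
definition sprob :: "nat \<Rightarrow> nat \<Rightarrow> nat set \<Rightarrow> real" where
  "sprob N p S = min 1 (hp_c * real p / (real (card (gamma N p S)) * real (logstar (real p))))"

definition hp_round :: "nat \<Rightarrow> nat \<Rightarrow> nat set \<Rightarrow> nat set pmf" where
  "hp_round N p S =
     map_pmf (\<lambda>b. S \<union> {x \<in> gamma N p S. b x})
       (Pi_pmf (gamma N p S) False (\<lambda>_. bernoulli_pmf (sprob N p S)))"

text \<open>Distribution of the state after n rounds (= before round n+1); initially nothing sampled.\<close>
primrec hp_state :: "nat \<Rightarrow> nat \<Rightarrow> nat \<Rightarrow> nat set pmf" where
  "hp_state N p 0 = return_pmf {}"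
| "hp_state N p (Suc n) = hp_state N p n \<bind> hp_round N p"

definition hp_step :: "nat \<Rightarrow> nat \<Rightarrow> nat \<Rightarrow> (nat set \<times> nat set) pmf" where
  "hp_step N p j = hp_state N p (j - 1) \<bind> (\<lambda>S. map_pmf (\<lambda>S'. (S, S')) (hp_round N p S))"

end

theory Submission
  imports Defs "HOL-Real_Asymp.Real_Asymp"
begin

text \<open>Write N = m p, so that splitter l has the m + 1 keys m l, ..., m l + m as its target
  range. For an unachieved splitter no sample lies strictly between L(l) and U(l), so every
  key of gamma is within distance about m of the target range of an unachieved splitter and
  |gamma| \<le> (3 m + 1) k. Hence, if k \<le> p / (t log* p), keys are sampled with probability
  q \<ge> c t / (3 m + 1), and a splitter stays unachieved with probability
  (1 - q)^(m+1) \<le> exp (- c t / 3) = 2.5^(-t) \<le> 0.8 \<cdot> 2^(-t). So the number X of splitters that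
  stay unachieved has mean at most 0.8 B, B being the claimed bound; as target ranges of
  splitters at distance at least 2 are disjoint, Var X \<le> 3 E X, and Chebyshev's inequality
  gives X \<le> B with probability at least 1 - 60 / B \<ge> 1 - 60 log p (log p + 1) / p.\<close>

section \<open>Iterated logarithm\<close>

lemma log2_le_minus_one:
  assumes "2 \<le> (y::real)"
  shows "log 2 y \<le> y - 1"
proof -
  have "1/2 \<le> ln (2::real)"
    using ln_le_minus_one[of "1/2 :: real"] by (simp add: ln_div)
  then have "ln (y/2) \<le> (y - 2) * ln 2"
    using ln_le_minus_one[of "y/2"] assms mult_left_mono[of "1/2" "ln 2" "y - 2"] by simp
  then have "ln y \<le> (y - 1) * ln 2"
    using assms by (simp add: ln_div algebra_simps)
  then show ?thesis
    by (simp add: log_def divide_le_eq)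
qed

lemma iterated_log_le_1:
  fixes y :: real
  assumes "y \<le> real K + 1"
  shows "\<exists>n\<le>K. ((\<lambda>y. log 2 y) ^^ n) y \<le> 1"
  using assms
proof (induction K arbitrary: y)
  case (Suc K)
  show ?case
  proof (cases "y \<le> 1")
    case False
    have "log 2 y \<le> real K + 1"
    proof (cases "y \<le> 2")
      case True
      then have "log 2 y \<le> log 2 2"
        using False by (subst log_le_cancel_iff) auto
      then show ?thesis
        by simp
    next
      case False
      then show ?thesis
        using log2_le_minus_one[of y] Suc.prems by simp
    qed
    then obtain n where "n \<le> K" "((\<lambda>y. log 2 y) ^^ n) (log 2 y) \<le> 1"
      using Suc.IH by blast
    then show ?thesis
      by (intro exI[of _ "Suc n"]) (simp add: funpow_Suc_right del: funpow.simps)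
  qed auto
qed auto

lemma logstar_ge_1:
  assumes "1 < x"
  shows "1 \<le> logstar x"
proof -
  have "x \<le> real (nat \<lceil>x\<rceil>) + 1"
    using assms by linarith
  then obtain n where "((\<lambda>y. log 2 y) ^^ n) x \<le> 1"
    using iterated_log_le_1 by blast
  then have "((\<lambda>y. log 2 y) ^^ logstar x) x \<le> 1"
    unfolding logstar_def by (rule LeastI)
  then show ?thesis
    using assms by (cases "logstar x") auto
qed

lemma logstar_le:
  assumes "1 \<le> x"
  shows "real (logstar x) \<le> log 2 x + 1"
proof -
  define K where "K = nat \<lfloor>log 2 x\<rfloor>"
  have "0 \<le> log 2 x"
    using assms by simp
  then have K: "real K \<le> log 2 x" "log 2 x \<le> real K + 1"
    unfolding K_def by linarith+
  then obtain n where n: "n \<le> K" "((\<lambda>y. log 2 y) ^^ n) (log 2 x) \<le> 1"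
    using iterated_log_le_1 by blast
  then have "logstar x \<le> Suc n"
    unfolding logstar_def by (intro Least_le) (simp add: funpow_Suc_right del: funpow.simps)
  then show ?thesis
    using n(1) K(1) by linarith
qed

section \<open>Target ranges when p divides N\<close>

definition target_keys :: "nat \<Rightarrow> nat \<Rightarrow> nat set" where
  "target_keys m l = {m*l..m*l+m}"

lemma tlo_mult: "0 < p \<Longrightarrow> tlo (m*p) p l = real (m*l)"
  by (simp add: tlo_def)

lemma thi_mult: "0 < p \<Longrightarrow> thi (m*p) p l = real (m*l+m)"
  by (simp add: thi_def)

lemma achieved_mult_iff:
  "0 < p \<Longrightarrow> achieved (m*p) p S l \<longleftrightarrow> S \<inter> target_keys m l \<noteq> {}"
  unfolding achieved_def tlo_mult thi_mult of_nat_le_iff target_keys_def by auto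

lemma mem_unach_mult_iff:
  "0 < p \<Longrightarrow> l \<in> unach (m*p) p S \<longleftrightarrow> l \<in> {1..p-1} \<and> S \<inter> target_keys m l = {}"
  by (simp add: unach_def achieved_mult_iff)

lemma Lkey_mult:
  "0 < p \<Longrightarrow> Lkey (m*p) p S l = (if {x\<in>S. x < m*l} = {} then 1 else Max {x\<in>S. x < m*l})"
  unfolding Lkey_def tlo_mult of_nat_less_iff ..

lemma Ukey_mult:
  "0 < p \<Longrightarrow> Ukey (m*p) p S l = (if {x\<in>S. m*l+m < x} = {} then m*p else Min {x\<in>S. m*l+m < x})"
  unfolding Ukey_def thi_mult of_nat_less_iff ..

context
  fixes m p :: nat and S :: "nat set"
  assumes m_pos: "1 \<le> m" and p_pos: "0 < p" and S_keys: "S \<subseteq> {1..m*p}"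
begin

lemma finite_samples: "finite S"
  using S_keys finite_subset by blast

lemma Lkey_in_samples:
  assumes "{x\<in>S. x < m*l} \<noteq> {}"
  shows "Lkey (m*p) p S l \<in> {x\<in>S. x < m*l}"
  unfolding Lkey_mult[OF p_pos] if_not_P[OF assms]
  using finite_samples assms by (intro Max_in) auto

lemma Ukey_in_samples:
  assumes "{x\<in>S. m*l+m < x} \<noteq> {}"
  shows "Ukey (m*p) p S l \<in> {x\<in>S. m*l+m < x}"
  unfolding Ukey_mult[OF p_pos] if_not_P[OF assms]
  using finite_samples assms by (intro Min_in) auto

lemma Lkey_ge_1: "1 \<le> Lkey (m*p) p S l"
proof (cases "{x\<in>S. x < m*l} = {}")
  case False
  then show ?thesis using Lkey_in_samples S_keys by force
qed (simp add: Lkey_mult[OF p_pos])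

lemma Lkey_le: "1 \<le> l \<Longrightarrow> Lkey (m*p) p S l \<le> m*l"
proof (cases "{x\<in>S. x < m*l} = {}")
  case True
  then show "1 \<le> l \<Longrightarrow> ?thesis" using m_pos by (simp add: Lkey_mult[OF p_pos])
qed (use Lkey_in_samples in force)

lemma Ukey_le: "Ukey (m*p) p S l \<le> m*p"
proof (cases "{x\<in>S. m*l+m < x} = {}")
  case False
  then show ?thesis using Ukey_in_samples S_keys by force
qed (simp add: Ukey_mult[OF p_pos])

lemma Ukey_ge: "l \<le> p - 1 \<Longrightarrow> m*l+m \<le> Ukey (m*p) p S l"
proof (cases "{x\<in>S. m*l+m < x} = {}")
  case True
  assume "l \<le> p - 1"
  then have "m*(l+1) \<le> m*p"
    using p_pos by (intro mult_le_mono2) simp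
  then show ?thesis using True by (simp add: Ukey_mult[OF p_pos])
qed (use Ukey_in_samples in force)

lemma no_sample_between_keys:
  assumes "l \<in> unach (m*p) p S" and "s \<in> S"
  shows "s \<notin> {Lkey (m*p) p S l<..<Ukey (m*p) p S l}"
proof
  assume between: "s \<in> {Lkey (m*p) p S l<..<Ukey (m*p) p S l}"
  have "s \<notin> target_keys m l"
    using assms p_pos by (auto simp: mem_unach_mult_iff)
  moreover have "\<not> s < m*l"
  proof
    assume "s < m*l"
    then have "s \<le> Lkey (m*p) p S l"
      using assms(2) finite_samples p_pos by (auto simp: Lkey_mult intro: Max_ge)
    then show False using between by simp
  qed
  moreover have "\<not> m*l+m < s"
  proof
    assume "m*l+m < s"
    then have "Ukey (m*p) p S l \<le> s"
      using assms(2) finite_samples p_pos by (auto simp: Ukey_mult intro: Min_le)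
    then show False using between by simp
  qed
  ultimately show False
    by (auto simp: target_keys_def)
qed

lemma unach_between_keys:
  assumes "l \<in> unach (m*p) p S" and "l' \<in> {1..p-1}"
    and "Lkey (m*p) p S l < m*l'" and "m*l'+m < Ukey (m*p) p S l"
  shows "l' \<in> unach (m*p) p S"
  using assms no_sample_between_keys[OF assms(1)] p_pos
  by (fastforce simp: mem_unach_mult_iff target_keys_def)

lemma gamma_subset_keys: "gamma (m*p) p S \<subseteq> {1..m*p}"
proof (unfold gamma_def, intro UN_least subsetI)
  fix l x
  assume "x \<in> {Lkey (m*p) p S l..Ukey (m*p) p S l}"
  then show "x \<in> {1..m*p}"
    using Lkey_ge_1[of l] Ukey_le[of l] by auto
qed

lemma finite_gamma: "finite (gamma (m*p) p S)"
  using gamma_subset_keys finite_subset by blast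

lemma target_keys_subset_gamma:
  assumes "l \<in> unach (m*p) p S"
  shows "target_keys m l \<subseteq> gamma (m*p) p S"
proof -
  have "target_keys m l \<subseteq> {Lkey (m*p) p S l..Ukey (m*p) p S l}"
    using assms p_pos Lkey_le Ukey_ge by (force simp: mem_unach_mult_iff target_keys_def)
  then show ?thesis
    using assms unfolding gamma_def by blast
qed

text \<open>A key x of gamma below (above) the keys near the target range of l is covered by the
  splitter whose target range lies just above (below) x: that range lies between x and the
  target range of l, hence strictly between L(l) and U(l).\<close>
lemma near_unach_below:
  assumes l: "l \<in> unach (m*p) p S" and x: "Lkey (m*p) p S l \<le> x" "x < m*(l-1)"
  shows "\<exists>l'\<in>unach (m*p) p S. x \<in> {m*(l'-1)..m*(l'+2)}"
proof -
  define l' where "l' = x div m + 1"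
  have x_l': "m*(l'-1) \<le> x" "x < m*l'"
    using dividend_less_times_div[of m x] m_pos by (simp_all add: l'_def)
  have "x div m < l - 1"
    using x(2) m_pos by (simp add: div_less_iff_less_mult mult.commute)
  then have "m*(l'+1) \<le> m*l"
    by (intro mult_le_mono2) (simp add: l'_def)
  moreover have "m*l+m \<le> Ukey (m*p) p S l"
    using l p_pos by (intro Ukey_ge) (simp add: mem_unach_mult_iff)
  ultimately have "l' \<in> unach (m*p) p S"
    using l x x_l' m_pos \<open>x div m < l - 1\<close> p_pos
    by (intro unach_between_keys[OF l]) (auto simp: l'_def mem_unach_mult_iff)
  moreover have "x \<in> {m*(l'-1)..m*(l'+2)}"
    using x_l' by simp
  ultimately show ?thesis by blast
qed

lemma near_unach_above:
  assumes l: "l \<in> unach (m*p) p S" and x: "x \<le> Ukey (m*p) p S l" "m*(l+2) < x"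
  shows "\<exists>l'\<in>unach (m*p) p S. x \<in> {m*(l'-1)..m*(l'+2)}"
proof -
  define d where "d = (x - 1) div m"
  have "m*d \<le> x - 1" "x - 1 < m + m*d"
    unfolding d_def using dividend_less_times_div[of m "x - 1"] m_pos by simp_all
  then have x_d: "m*d < x" "x \<le> m*d + m"
    using x(2) by linarith+
  have "m*(l+2) < m*(d+1)"
    using x(2) x_d by simp
  then have d_l: "l + 2 \<le> d"
    by (simp only: mult_less_cancel1) simp
  define l' where "l' = d - 1"
  have d_l': "d = l' + 1"
    using d_l by (simp add: l'_def)
  have "m*d < m*p"
    using x x_d Ukey_le[of l] by linarith
  then have "d < p"
    by simp
  then have "l' \<in> {1..p-1}"
    using d_l by (simp add: d_l')
  moreover have "m*(l+1) \<le> m*l'"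
    using d_l by (intro mult_le_mono2) (simp add: d_l')
  moreover have "Lkey (m*p) p S l \<le> m*l"
    using l p_pos by (intro Lkey_le) (simp add: mem_unach_mult_iff)
  ultimately have "l' \<in> unach (m*p) p S"
    using x x_d m_pos by (intro unach_between_keys[OF l]) (auto simp: d_l')
  moreover have "x \<in> {m*(l'-1)..m*(l'+2)}"
  proof -
    have "m*(l'-1) \<le> m*d"
      by (intro mult_le_mono2) (simp add: d_l')
    then show ?thesis
      using x_d by (simp add: d_l')
  qed
  ultimately show ?thesis by blast
qed

lemma gamma_subset_near_unach:
  "gamma (m*p) p S \<subseteq> (\<Union>l\<in>unach (m*p) p S. {m*(l-1)..m*(l+2)})"
proof (unfold gamma_def, intro UN_least subsetI)
  fix l x
  assume l: "l \<in> unach (m*p) p S" and x: "x \<in> {Lkey (m*p) p S l..Ukey (m*p) p S l}"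
  consider "x < m*(l-1)" | "m*(l+2) < x" | "x \<in> {m*(l-1)..m*(l+2)}"
    by fastforce
  then show "x \<in> (\<Union>l\<in>unach (m*p) p S. {m*(l-1)..m*(l+2)})"
  proof cases
    case 1
    then show ?thesis using near_unach_below[OF l] x by auto
  next
    case 2
    then show ?thesis using near_unach_above[OF l] x by auto
  qed (use l in blast)
qed

lemma card_gamma_le: "card (gamma (m*p) p S) \<le> card (unach (m*p) p S) * (3*m+1)"
proof -
  have "card (gamma (m*p) p S) \<le> card (\<Union>l\<in>unach (m*p) p S. {m*(l-1)..m*(l+2)})"
    using gamma_subset_near_unach by (intro card_mono) (simp_all add: unach_def)
  also have "\<dots> \<le> (\<Sum>l\<in>unach (m*p) p S. card {m*(l-1)..m*(l+2)})"
    by (rule card_UN_le) (simp add: unach_def)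
  also have "\<dots> \<le> (\<Sum>l\<in>unach (m*p) p S. 3*m+1)"
    by (intro sum_mono) (cases "l = 0"; simp add: algebra_simps)
  finally show ?thesis
    by simp
qed

lemma unach_after_sampling:
  "unach (m*p) p (S \<union> {x\<in>gamma (m*p) p S. b x}) =
     {l\<in>unach (m*p) p S. \<forall>x\<in>target_keys m l. \<not> b x}"
proof (rule set_eqI)
  fix l
  show "l \<in> unach (m*p) p (S \<union> {x\<in>gamma (m*p) p S. b x}) \<longleftrightarrow>
      l \<in> {l\<in>unach (m*p) p S. \<forall>x\<in>target_keys m l. \<not> b x}"
  proof (cases "l \<in> unach (m*p) p S")
    case True
    then have "target_keys m l \<subseteq> gamma (m*p) p S"
      by (rule target_keys_subset_gamma)
    then show ?thesis
      using True p_pos by (auto simp: mem_unach_mult_iff)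
  qed (use p_pos in \<open>auto simp: mem_unach_mult_iff\<close>)
qed

end

lemma hp_state_subset_keys:
  assumes "1 \<le> m" "0 < p" "S \<in> set_pmf (hp_state (m*p) p n)"
  shows "S \<subseteq> {1..m*p}"
  using assms(3)
proof (induction n arbitrary: S)
  case (Suc n)
  then obtain S0 b where "S0 \<in> set_pmf (hp_state (m*p) p n)" "S = S0 \<union> {x \<in> gamma (m*p) p S0. b x}"
    by (auto simp: hp_round_def)
  then show ?case
    using Suc.IH gamma_subset_keys[OF assms(1,2)] by blast
qed simp

lemma target_keys_disjoint:
  assumes "1 \<le> m" "l' \<notin> {l-1..l+1}"
  shows "target_keys m l \<inter> target_keys m l' = {}"
proof -
  have "m*l+m < m*l' \<or> m*l'+m < m*l"
  proof (cases "l < l'")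
    case True
    then have "m*(l+1) < m*l'"
      using assms by (intro mult_less_mono2) auto
    then show ?thesis by simp
  next
    case False
    then have "m*(l'+1) < m*l"
      using assms by (intro mult_less_mono2) auto
    then show ?thesis by simp
  qed
  then show ?thesis
    by (auto simp: target_keys_def)
qed

section \<open>Sampling probability\<close>

lemma hp_c_pos: "0 < hp_c"
  by (simp add: hp_c_def)

text \<open>The constant c = 3 ln 2.5 is chosen so that exp (-c t / 3) = 2.5 powr (-t).\<close>
lemma miss_prob_le:
  assumes "0 \<le> q" "q \<le> 1" "min 1 (hp_c * t / (3 * real m + 1)) \<le> q" "1 \<le> t"
  shows "(1 - q) ^ (m + 1) \<le> 4/5 / 2 powr t"
proof (cases "q = 1")
  case False
  then have q_ge: "hp_c * t / (3 * real m + 1) \<le> q"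
    using assms(2,3) by linarith
  have "(1 - q) ^ (m + 1) \<le> exp (-q) ^ (m + 1)"
    using assms(2) by (intro power_mono) (auto simp: exp_ge_add_one_self[of "-q", simplified])
  also have "\<dots> = exp (- (q * real (m + 1)))"
    by (subst exp_of_nat_mult[symmetric]) (simp add: mult.commute)
  also have "\<dots> \<le> exp (- (t * ln (5/2)))"
  proof -
    have "hp_c * t / 3 \<le> hp_c * t / (3 * real m + 1) * real (m + 1)"
      using hp_c_pos assms(4) by (simp add: field_simps)
    also have "\<dots> \<le> q * real (m + 1)"
      using q_ge by (intro mult_right_mono) auto
    finally show ?thesis
      by (simp add: hp_c_def mult.commute)
  qed
  also have "\<dots> = 1 / (5/2) powr t"
    by (simp add: powr_def exp_minus field_simps)
  also have "\<dots> = 1 / (2 powr t * (5/4) powr t)"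
    by (simp flip: powr_mult)
  also have "\<dots> \<le> 4/5 / 2 powr t"
    using powr_mono[OF assms(4), of "5/4 :: real"] by (simp add: field_simps)
  finally show ?thesis .
qed simp

lemma sprob_nonneg: "0 \<le> sprob N p S"
  using hp_c_pos by (simp add: sprob_def)

lemma sprob_ge:
  fixes t :: real
  assumes m_pos: "1 \<le> m" and p_pos: "0 < p" and S_keys: "S \<subseteq> {1..m*p}"
    and unach_ne: "unach (m*p) p S \<noteq> {}" and L_ge_1: "1 \<le> logstar p" and "0 < t"
    and few: "card (unach (m*p) p S) \<le> p / (t * logstar p)"
  shows "min 1 (hp_c * t / (3 * real m + 1)) \<le> sprob (m*p) p S"
proof -
  define g where "g = real (card (gamma (m*p) p S))"
  define L where "L = real (logstar p)"
  obtain l where "l \<in> unach (m*p) p S"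
    using unach_ne by blast
  then have "card (target_keys m l) \<le> card (gamma (m*p) p S)"
    using m_pos p_pos S_keys by (intro card_mono finite_gamma target_keys_subset_gamma)
  then have g_pos: "0 < g"
    by (simp add: g_def target_keys_def)
  have "g \<le> real (card (unach (m*p) p S) * (3*m+1))"
    unfolding g_def of_nat_le_iff by (rule card_gamma_le[OF m_pos p_pos S_keys])
  also have "\<dots> = card (unach (m*p) p S) * (3 * real m + 1)"
    by (simp add: algebra_simps)
  also have "\<dots> \<le> p / (t * L) * (3 * real m + 1)"
    using few by (intro mult_right_mono) (simp_all add: L_def)
  finally have "t * L * g \<le> (3 * real m + 1) * p"
    using L_ge_1 \<open>0 < t\<close> by (simp add: L_def field_simps)
  then have "t / (3 * real m + 1) \<le> p / (g * L)"
    using g_pos L_ge_1 by (simp add: L_def field_simps)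
  then have "hp_c * t / (3 * real m + 1) \<le> hp_c * p / (g * L)"
    using mult_left_mono[of _ _ hp_c] hp_c_pos by fastforce
  then show ?thesis
    by (simp add: sprob_def g_def L_def)
qed

section \<open>Independent coin flips\<close>

definition indep_coins :: "'a set \<Rightarrow> real \<Rightarrow> ('a \<Rightarrow> bool) pmf" where
  "indep_coins A q = Pi_pmf A False (\<lambda>_. bernoulli_pmf q)"

lemma finite_set_indep_coins: "finite A \<Longrightarrow> finite (set_pmf (indep_coins A q))"
proof -
  assume "finite A"
  then have "set_pmf (indep_coins A q) \<subseteq> PiE_dflt A False (\<lambda>_. UNIV)"
    using set_Pi_pmf_subset by (fastforce simp: indep_coins_def PiE_dflt_def)
  moreover have "finite (PiE_dflt A False (\<lambda>_. UNIV :: bool set))"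
    using \<open>finite A\<close> by (intro finite_PiE_dflt) auto
  ultimately show ?thesis
    using finite_subset by blast
qed

lemma integrable_indep_coins:
  "finite A \<Longrightarrow> integrable (indep_coins A q) (f :: _ \<Rightarrow> real)"
  by (rule integrable_measure_pmf_finite) (rule finite_set_indep_coins)

lemma prod_of_bool:
  "finite A \<Longrightarrow> (\<Prod>x\<in>A. of_bool (P x) :: 'b::comm_semiring_1) = of_bool (\<forall>x\<in>A. P x)"
  by (induction A rule: finite_induct) auto

lemma expectation_indep_coins_all_tails:
  assumes "finite G" "0 \<le> q" "q \<le> 1" "A \<subseteq> G"
  shows "measure_pmf.expectation (indep_coins G q) (\<lambda>b. of_bool (\<forall>x\<in>A. \<not> b x) :: real)
           = (1 - q) ^ card A"
proof -
  have finite_A: "finite A"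
    using assms finite_subset by blast
  have "(of_bool (\<forall>x\<in>A. \<not> b x) :: real) = (\<Prod>x\<in>G. if x \<in> A then of_bool (\<not> b x) else 1)" for b
    using finite_A Int_absorb1[OF assms(4)]
    by (simp add: prod.inter_restrict[OF assms(1), symmetric] prod_of_bool)
  then have "measure_pmf.expectation (indep_coins G q) (\<lambda>b. of_bool (\<forall>x\<in>A. \<not> b x) :: real)
      = (\<Prod>x\<in>G. measure_pmf.expectation (bernoulli_pmf q)
                   (\<lambda>v. if x \<in> A then of_bool (\<not> v) else 1 :: real))"
    unfolding indep_coins_def
    by (simp only:) (rule expectation_prod_Pi_pmf[OF assms(1)]; simp add: integrable_measure_pmf_finite)
  also have "\<dots> = (\<Prod>x\<in>G. if x \<in> A then 1 - q else 1)"
    using assms(2,3) by (intro prod.cong) auto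
  also have "\<dots> = (1 - q) ^ card A"
    using Int_absorb1[OF assms(4)] by (simp add: prod.inter_restrict[OF assms(1), symmetric])
  finally show ?thesis .
qed

locale coin_targets =
  fixes G :: "'a set" and q :: real and U :: "nat set" and T :: "nat \<Rightarrow> 'a set" and n :: nat
  assumes finite_G: "finite G" and q_nonneg: "0 \<le> q" and q_le_1: "q \<le> 1"
    and finite_U: "finite U"
    and T_subset: "l \<in> U \<Longrightarrow> T l \<subseteq> G"
    and card_T: "l \<in> U \<Longrightarrow> card (T l) = n"
    and T_disjoint: "l \<in> U \<Longrightarrow> l' \<in> U \<Longrightarrow> l' \<notin> {l-1..l+1} \<Longrightarrow> T l \<inter> T l' = {}"
begin

definition unhit :: "('a \<Rightarrow> bool) \<Rightarrow> real" where
  "unhit b = (\<Sum>l\<in>U. of_bool (\<forall>x\<in>T l. \<not> b x))"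

lemma unhit_eq_card: "unhit b = card {l\<in>U. \<forall>x\<in>T l. \<not> b x}"
  using finite_U by (simp add: unhit_def Int_def conj_commute)

lemma expectation_unhit:
  "measure_pmf.expectation (indep_coins G q) unhit = card U * (1 - q) ^ n"
proof -
  have "measure_pmf.expectation (indep_coins G q) unhit
      = (\<Sum>l\<in>U. measure_pmf.expectation (indep_coins G q) (\<lambda>b. of_bool (\<forall>x\<in>T l. \<not> b x)))"
    unfolding unhit_def by (intro Bochner_Integration.integral_sum integrable_indep_coins finite_G)
  also have "\<dots> = (\<Sum>l\<in>U. (1 - q) ^ n)"
    using expectation_indep_coins_all_tails[OF finite_G q_nonneg q_le_1] T_subset card_T
    by (intro sum.cong) auto
  finally show ?thesis
    by simp
qed

lemma expectation_both_unhit_le: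
  assumes "l \<in> U" "l' \<in> U"
  shows "measure_pmf.expectation (indep_coins G q) (\<lambda>b. of_bool (\<forall>x\<in>T l \<union> T l'. \<not> b x))
           \<le> ((1 - q) ^ n)\<^sup>2 + (if l' \<in> {l-1..l+1} then (1 - q) ^ n else 0)"
proof -
  have finite_T: "finite (T l)" "finite (T l')"
    using assms T_subset finite_G finite_subset by blast+
  have "measure_pmf.expectation (indep_coins G q) (\<lambda>b. of_bool (\<forall>x\<in>T l \<union> T l'. \<not> b x))
      = (1 - q) ^ card (T l \<union> T l')"
    using assms T_subset by (intro expectation_indep_coins_all_tails finite_G q_nonneg q_le_1) auto
  also have "\<dots> \<le> ((1 - q) ^ n)\<^sup>2 + (if l' \<in> {l-1..l+1} then (1 - q) ^ n else 0)"
  proof (cases "l' \<in> {l-1..l+1}")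
    case True
    have "n \<le> card (T l \<union> T l')"
      using card_T[OF assms(1)] finite_T by (metis card_mono finite_UnI sup_ge1)
    then have "(1 - q) ^ card (T l \<union> T l') \<le> (1 - q) ^ n"
      using q_nonneg q_le_1 by (intro power_decreasing) auto
    then show ?thesis
      using True by (simp add: add_increasing)
  next
    case False
    then have "card (T l \<union> T l') = n + n"
      using T_disjoint assms finite_T card_T by (simp add: card_Un_disjoint)
    then show ?thesis
      using False by (simp add: power_add power2_eq_square del: atLeastAtMost_iff)
  qed
  finally show ?thesis .
qed

lemma variance_unhit_le:
  "measure_pmf.variance (indep_coins G q) unhit \<le> 3 * (card U * (1 - q) ^ n)"
proof -
  define r where "r = (1 - q) ^ n"
  have r_nonneg: "0 \<le> r"
    using q_le_1 by (simp add: r_def)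
  have unhit_sq: "(unhit b)\<^sup>2 = (\<Sum>l\<in>U. \<Sum>l'\<in>U. of_bool (\<forall>x\<in>T l \<union> T l'. \<not> b x))" for b
    unfolding unhit_def power2_eq_square sum_product by (intro sum.cong refl) auto
  have neighbours: "(\<Sum>l'\<in>U. if l' \<in> {l-1..l+1} then r else 0) \<le> 3 * r" for l
  proof -
    have "(\<Sum>l'\<in>U. if l' \<in> {l-1..l+1} then r else 0) = card (U \<inter> {l-1..l+1}) * r"
      using sum.inter_restrict[OF finite_U, of "\<lambda>_. r" "{l-1..l+1}"] by simp
    also have "card (U \<inter> {l-1..l+1}) \<le> card {l-1..l+1}"
      by (intro card_mono) auto
    also have "card {l-1..l+1} \<le> 3"
      by simp
    finally show ?thesis
      using r_nonneg by (simp add: mult_right_mono)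
  qed
  have "measure_pmf.expectation (indep_coins G q) (\<lambda>b. (unhit b)\<^sup>2)
      = (\<Sum>l\<in>U. \<Sum>l'\<in>U. measure_pmf.expectation (indep_coins G q)
                               (\<lambda>b. of_bool (\<forall>x\<in>T l \<union> T l'. \<not> b x)))"
    unfolding unhit_sq
    by (simp add: Bochner_Integration.integral_sum integrable_indep_coins finite_G)
  also have "\<dots> \<le> (\<Sum>l\<in>U. \<Sum>l'\<in>U. r\<^sup>2 + (if l' \<in> {l-1..l+1} then r else 0))"
    unfolding r_def by (intro sum_mono expectation_both_unhit_le)
  also have "\<dots> \<le> (\<Sum>l\<in>U. card U * r\<^sup>2 + 3 * r)"
    using neighbours by (intro sum_mono) (simp add: sum.distrib)
  also have "\<dots> = (card U * r)\<^sup>2 + 3 * (card U * r)"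
    by (simp add: power2_eq_square algebra_simps)
  finally show ?thesis
    using expectation_unhit
    by (subst measure_pmf.variance_eq) (simp_all add: r_def integrable_indep_coins finite_G)
qed

text \<open>Chebyshev's inequality with deviation B/5 from a mean of at most 4B/5.\<close>
lemma prob_unhit_le:
  assumes "card U * (1 - q) ^ n \<le> 4/5 * B" "0 < B"
  shows "1 - 60 / B \<le> measure_pmf.prob (indep_coins G q) {b. unhit b \<le> B}"
proof -
  let ?M = "measure_pmf (indep_coins G q)"
  let ?\<mu> = "measure_pmf.expectation (indep_coins G q) unhit"
  have "measure_pmf.prob (indep_coins G q) {b. B < unhit b}
      \<le> measure_pmf.prob (indep_coins G q) {b \<in> space ?M. B/5 \<le> \<bar>unhit b - ?\<mu>\<bar>}"
    using assms(1) expectation_unhit by (intro measure_pmf.finite_measure_mono) (auto simp: abs_if)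
  also have "\<dots> \<le> measure_pmf.variance (indep_coins G q) unhit / (B/5)\<^sup>2"
    using assms(2) by (intro measure_pmf.Chebyshev_inequality) (simp_all add: integrable_indep_coins finite_G)
  also have "\<dots> \<le> 3 * (4/5 * B) / (B/5)\<^sup>2"
    using variance_unhit_le assms by (intro divide_right_mono) auto
  also have "\<dots> = 60 / B"
    using assms(2) by (simp add: power2_eq_square field_simps)
  finally show ?thesis
    using measure_pmf.prob_compl[of "{b. B < unhit b}" "indep_coins G q"]
    by (simp add: Compl_eq_Diff_UNIV[symmetric] Collect_neg_eq[symmetric] not_less)
qed

end

section \<open>One round\<close>

lemma hp_round_eq_indep_coins:
  "hp_round N p S = map_pmf (\<lambda>b. S \<union> {x\<in>gamma N p S. b x}) (indep_coins (gamma N p S) (sprob N p S))"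
  by (simp add: hp_round_def indep_coins_def)

lemma coin_targets_unach:
  assumes m_pos: "1 \<le> m" and p_pos: "0 < p" and S_keys: "S \<subseteq> {1..m*p}"
  shows "coin_targets (gamma (m*p) p S) (sprob (m*p) p S) (unach (m*p) p S) (target_keys m) (m + 1)"
proof (rule coin_targets.intro)
  show "finite (gamma (m*p) p S)"
    by (rule finite_gamma[OF m_pos p_pos S_keys])
  show "0 \<le> sprob (m*p) p S"
    by (rule sprob_nonneg)
  show "sprob (m*p) p S \<le> 1"
    by (simp add: sprob_def)
  show "finite (unach (m*p) p S)"
    by (simp add: unach_def)
  show "target_keys m l \<subseteq> gamma (m*p) p S" if "l \<in> unach (m*p) p S" for l
    using that by (rule target_keys_subset_gamma[OF m_pos p_pos S_keys])
  show "card (target_keys m l) = m + 1" for l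
    by (simp add: target_keys_def)
  show "target_keys m l \<inter> target_keys m l' = {}" if "l' \<notin> {l-1..l+1}" for l l'
    using m_pos that by (rule target_keys_disjoint)
qed

lemma unach_miss_prob_le:
  fixes t :: real
  assumes m_pos: "1 \<le> m" and p_ge_2: "2 \<le> p" and S_keys: "S \<subseteq> {1..m*p}" and "1 \<le> t"
    and few: "card (unach (m*p) p S) \<le> p / (t * logstar p)"
  shows "card (unach (m*p) p S) * (1 - sprob (m*p) p S) ^ (m + 1)
           \<le> 4/5 * (p / (t * 2 powr t * logstar p))"
proof (cases "unach (m*p) p S = {}")
  case False
  have "min 1 (hp_c * t / (3 * real m + 1)) \<le> sprob (m*p) p S"
    using m_pos p_ge_2 S_keys False logstar_ge_1[of p] \<open>1 \<le> t\<close> few by (intro sprob_ge) auto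
  then have "(1 - sprob (m*p) p S) ^ (m + 1) \<le> 4/5 / 2 powr t"
    using sprob_nonneg \<open>1 \<le> t\<close> by (intro miss_prob_le) (simp_all add: sprob_def)
  then have "card (unach (m*p) p S) * (1 - sprob (m*p) p S) ^ (m + 1)
      \<le> p / (t * logstar p) * (4/5 / 2 powr t)"
    using few by (intro mult_mono) (simp_all add: sprob_def)
  also have "\<dots> = 4/5 * (p / (t * 2 powr t * logstar p))"
    by (simp add: field_simps)
  finally show ?thesis .
qed (use \<open>1 \<le> t\<close> in simp)

lemma prob_hp_round_few_unach:
  fixes t B :: real
  assumes m_pos: "1 \<le> m" and p_ge_2: "2 \<le> p" and S_keys: "S \<subseteq> {1..m*p}" and "1 \<le> t"
    and B: "real p / (t * 2 powr t * real (logstar (real p))) \<le> B" "0 < B"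
  shows "1 - 60 / B \<le> measure_pmf.prob (hp_round (m*p) p S)
           {S'. real (card (unach (m*p) p S)) \<le> real p / (t * real (logstar (real p))) \<longrightarrow>
                real (card (unach (m*p) p S')) \<le> B}"
proof -
  define U where "U = unach (m*p) p S"
  define G where "G = gamma (m*p) p S"
  define q where "q = sprob (m*p) p S"
  have p_pos: "0 < p"
    using p_ge_2 by simp
  interpret coin_targets G q U "target_keys m" "m + 1"
    unfolding G_def q_def U_def by (rule coin_targets_unach[OF m_pos p_pos S_keys])
  have after: "unach (m*p) p (S \<union> {x\<in>G. b x}) = {l\<in>U. \<forall>x\<in>target_keys m l. \<not> b x}" for b
    unfolding G_def U_def by (rule unach_after_sampling[OF m_pos p_pos S_keys])
  let ?few = "real (card U) \<le> real p / (t * real (logstar (real p)))"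
  have "measure_pmf.prob (hp_round (m*p) p S)
          {S'. real (card (unach (m*p) p S)) \<le> real p / (t * real (logstar (real p))) \<longrightarrow>
               real (card (unach (m*p) p S')) \<le> B}
      = measure_pmf.prob (indep_coins G q) {b. ?few \<longrightarrow> unhit b \<le> B}"
    by (simp add: hp_round_eq_indep_coins after vimage_def flip: unhit_eq_card U_def G_def q_def)
  also have "1 - 60 / B \<le> \<dots>"
  proof (cases ?few)
    case True
    then have "card U * (1 - q) ^ (m + 1) \<le> 4/5 * (real p / (t * 2 powr t * real (logstar (real p))))"
      unfolding U_def q_def by (rule unach_miss_prob_le[OF m_pos p_ge_2 S_keys \<open>1 \<le> t\<close>])
    also have "\<dots> \<le> 4/5 * B"
      using B(1) by (rule mult_left_mono) simp
    finally show ?thesis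
      using True prob_unhit_le B(2) by simp
  qed (use B(2) in simp)
  finally show ?thesis .
qed

lemma prob_bind_pmf_ge:
  assumes "\<And>x. x \<in> set_pmf M \<Longrightarrow> c \<le> measure_pmf.prob (K x) E"
  shows "c \<le> measure_pmf.prob (bind_pmf M K) E"
proof (cases "c \<le> 0")
  case False
  have "ennreal c \<le> (\<integral>\<^sup>+x. emeasure (K x) E \<partial>M)"
    using assms by (intro measure_pmf.nn_integral_ge_const AE_pmfI)
      (simp add: measure_pmf.emeasure_eq_measure)
  also have "\<dots> = emeasure (bind_pmf M K) E"
    by simp
  also have "\<dots> = ennreal (measure_pmf.prob (bind_pmf M K) E)"
    by (simp add: measure_pmf.emeasure_eq_measure)
  finally show ?thesis
    using False by simp
qed (meson measure_nonneg order_trans)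

lemma failure_prob_le:
  assumes "2 \<le> p" and "real p / (log 2 p * logstar p) \<le> B"
  shows "0 < B" and "60 / B \<le> 60 * log 2 p * (log 2 p + 1) / p"
proof -
  have L: "1 \<le> real (logstar p)" "logstar p \<le> log 2 p + 1"
    using assms(1) logstar_ge_1[of p] logstar_le[of p] by simp_all
  have "1 \<le> log 2 p"
    using assms(1) by simp
  then have pos: "0 < real p / (log 2 p * logstar p)"
    using assms(1) L by (intro divide_pos_pos mult_pos_pos) auto
  then show "0 < B"
    using assms(2) by linarith
  have "60 / B \<le> 60 / (real p / (log 2 p * logstar p))"
    using pos assms(2) by (intro frac_le) auto
  also have "\<dots> = 60 * log 2 p * logstar p / p"
    by simp
  also have "\<dots> \<le> 60 * log 2 p * (log 2 p + 1) / p"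
    using L \<open>1 \<le> log 2 p\<close> by (intro divide_right_mono mult_left_mono) auto
  finally show "60 / B \<le> 60 * log 2 p * (log 2 p + 1) / p" .
qed

lemma prob_hp_step_few_unach:
  fixes t :: real
  assumes p_ge_2: "2 \<le> p" and "0 < N" "p dvd N" and "1 \<le> t"
  shows "1 - 60 * log 2 p * (log 2 p + 1) / p \<le> measure_pmf.prob (hp_step N p j)
          {(S, S'). real (card (unach N p S)) \<le> real p / (t * real (logstar (real p))) \<longrightarrow>
                    real (card (unach N p S')) \<le>
                      max (real p / (log 2 (real p) * real (logstar (real p))))
                          (real p / (t * 2 powr t * real (logstar (real p))))}"
    (is "_ \<le> measure_pmf.prob _ ?E")
proof -
  obtain m where "N = p * m"
    using \<open>p dvd N\<close> by (rule dvdE)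
  moreover from this have "0 < m"
    using \<open>0 < N\<close> by simp
  ultimately have m: "N = m * p" "1 \<le> m"
    by (simp_all add: mult.commute)
  define B where "B = max (real p / (log 2 p * logstar p)) (real p / (t * 2 powr t * logstar p))"
  note B = failure_prob_le[OF p_ge_2, of B]
  have "1 - 60 * log 2 p * (log 2 p + 1) / p \<le> 1 - 60 / B"
    using B by (simp add: B_def)
  also have "\<dots> \<le> measure_pmf.prob (hp_step N p j) ?E"
    unfolding hp_step_def
  proof (rule prob_bind_pmf_ge)
    fix S
    assume "S \<in> set_pmf (hp_state N p (j - 1))"
    then have "S \<subseteq> {1..m*p}"
      using m p_ge_2 by (intro hp_state_subset_keys) auto
    with m p_ge_2 \<open>1 \<le> t\<close> B
    have "1 - 60 / B \<le> measure_pmf.prob (hp_round (m*p) p S)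
           {S'. real (card (unach (m*p) p S)) \<le> real p / (t * logstar p) \<longrightarrow>
                real (card (unach (m*p) p S')) \<le> B}"
      by (intro prob_hp_round_few_unach) (auto simp: B_def)
    then show "1 - 60 / B \<le> measure_pmf.prob (map_pmf (Pair S) (hp_round N p S)) ?E"
      by (simp add: vimage_def m(1) B_def)
  qed
  finally show ?thesis .
qed

theorem lemma2p5:
  "\<exists>f :: nat \<Rightarrow> real. f \<longlonglongrightarrow> 1 \<and>
     (\<forall>p N j (t::real). 2 \<le> p \<longrightarrow> 0 < N \<longrightarrow> p dvd N \<longrightarrow> 1 \<le> j \<longrightarrow> 1 \<le> t \<longrightarrow>
        f p \<le> measure_pmf.prob (hp_step N p j)
          {(S, S'). real (card (unach N p S)) \<le> real p / (t * real (logstar (real p))) \<longrightarrow>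
                    real (card (unach N p S')) \<le>
                      max (real p / (log 2 (real p) * real (logstar (real p))))
                          (real p / (t * 2 powr t * real (logstar (real p))))})"
proof (intro exI conjI allI impI)
  show "(\<lambda>p::nat. 1 - 60 * log 2 p * (log 2 p + 1) / p) \<longlonglongrightarrow> 1"
    by real_asymp
qed (rule prob_hp_step_few_unach)

end
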